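(* Let $r$ be a non-negative integer. The generating function $I(r;\mathbf{x},\mathbf{y})=\sum_{\mathbf{v}}\iota_{\mathbf{v}}(r)\cdot\mathbf{v}$ of the Ehrhart polynomials of the descent polytopes, where the sum is over all $\mathbf{x}\mathbf{y}$-words $\mathbf{v}$ (including the empty word), is given by $$I(r;\mathbf{x},\mathbf{y})=(1-\mathbf{y})^{-1}\cdot Q_r\Big((\mathbf{x}-\mathbf{y})(1-\mathbf{y})^{-1}\Big)\cdot\left(1-\mathbf{y}(1-\mathbf{y})^{-1}\cdot Q_r\Big((\mathbf{x}-\mathbf{y})(1-\mathbf{y})^{-1}\Big)\right)^{-1},$$ where $Q_r(x)=x^{-1}\cdot\left((1-x)^{-r-1}-1\right)$.
   Context: The identity is in the ring of formal power series in two non-commuting variables $\mathbf{x},\mathbf{y}$. An $\mathbf{x}\mathbf{y}$-word is a finite (possibly empty) word in the letters $\mathbf{x},\mathbf{y}$, identified with a non-commutative monomial; the empty word is $1$. For a series $g$ with zero constant term, $(1-g)^{-1}=\sum_{k\ge0}g^k$. $Q_r(x)$ is understood as the one-variable power series $Q_r(x)=\sum_{j\ge 1}\binom{r+j}{j}x^{j-1}$, into which a non-commutative series with zero constant term may be substituted. Descent polytope: for an $\mathbf{x}\mathbf{y}$-word $\mathbf{v}=\mathbf{v}_1\cdots\mathbf{v}_{n-1}$ of length $n-1$ ($n\ge 1$), $\mathrm{DP}_{\mathbf{v}}\subset\mathbb{R}^n$ is the set of points $(x_1,\dots,x_n)$ with $0\le x_i\le 1$ for all $i$, and, for $1\le i\le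 n-1$, $x_i\le x_{i+1}$ if $\mathbf{v}_i=\mathbf{x}$ and $x_i\ge x_{i+1}$ if $\mathbf{v}_i=\mathbf{y}$. Ehrhart polynomial: $\iota_{\mathbf{v}}(r)$ is the number of lattice points in the dilation $r\cdot\mathrm{DP}_{\mathbf{v}}$, i.e. the number of $(x_1,\dots,x_n)\in\mathbb{Z}^n$ with $0\le x_i\le r$ for all $i$, $x_i\le x_{i+1}$ if $\mathbf{v}_i=\mathbf{x}$, and $x_i\ge x_{i+1}$ if $\mathbf{v}_i=\mathbf{y}$. *)

theory Defs
  imports "HOL-Computational_Algebra.Formal_Power_Series"
begin

datatype letter = LX | LY

text \<open>A word is a \<open>letter list\<close>; a series is the family of its coefficients.\<close>

typedef 'a ncfps = "UNIV :: (letter list \<Rightarrow> 'a) set"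
  morphisms nc_nth Abs_ncfps
  by simp

lemma nc_nth_Abs [simp]: "nc_nth (Abs_ncfps f) = f"
  by (simp add: Abs_ncfps_inverse)

lemma ncfps_eqI: "(\<And>w. nc_nth f w = nc_nth g w) \<Longrightarrow> f = g"
  by (simp add: nc_nth_inject[symmetric] fun_eq_iff)

instantiation ncfps :: (ring_1) ring_1
begin

definition "0 = Abs_ncfps (\<lambda>w. 0)"
definition "1 = Abs_ncfps (\<lambda>w. if w = [] then 1 else 0)"
definition "f + g = Abs_ncfps (\<lambda>w. nc_nth f w + nc_nth g w)"
definition "f - g = Abs_ncfps (\<lambda>w. nc_nth f w - nc_nth g w)"
definition "- f = Abs_ncfps (\<lambda>w. - nc_nth f w)"

text \<open>Each factorisation of \<open>w\<close> into two words is a split at some position \<open>k\<close>.\<close>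

definition "f * g = Abs_ncfps (\<lambda>w. \<Sum>k\<le>length w. nc_nth f (take k w) * nc_nth g (drop k w))"

lemma nc_mult_assoc: "(f * g) * h = f * (g * (h :: 'a ncfps))"
proof (rule ncfps_eqI)
  fix w :: "letter list"
  let ?t = "\<lambda>j k. nc_nth f (take j w) * nc_nth g (take k (drop j w)) * nc_nth h (drop (j + k) w)"
  have "nc_nth ((f * g) * h) w = (\<Sum>k\<le>length w. \<Sum>j\<le>k. ?t j (k - j))"
    unfolding times_ncfps_def
    by (auto simp: sum_distrib_right min_def take_drop intro!: sum.cong)
  also have "\<dots> = (\<Sum>(j, k)\<in>{(j, k). j + k \<le> length w}. ?t j k)"
    by (rule sum.triangle_reindex_eq[symmetric])
  also have "\<dots> = (\<Sum>(j, k)\<in>Sigma {..length w} (\<lambda>j. {..length w - j}). ?t j k)"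
    by (rule sum.cong) auto
  also have "\<dots> = (\<Sum>j\<le>length w. \<Sum>k\<le>length w - j. ?t j k)"
    by (subst sum.Sigma) auto
  also have "\<dots> = nc_nth (f * (g * h)) w"
    unfolding times_ncfps_def
    by (auto simp: sum_distrib_left mult.assoc add.commute intro!: sum.cong)
  finally show "nc_nth ((f * g) * h) w = nc_nth (f * (g * h)) w" .
qed

instance
proof
  fix f g h :: "'a ncfps"
  show "f * g * h = f * (g * h)" by (rule nc_mult_assoc)
  show "1 * f = f"
  proof (rule ncfps_eqI)
    fix w
    have "nc_nth (1 * f) w = (\<Sum>k\<le>length w. if k = 0 then nc_nth f w else 0)"
      unfolding times_ncfps_def one_ncfps_def nc_nth_Abs
      by (rule sum.cong) auto
    then show "nc_nth (1 * f) w = nc_nth f w" by simp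
  qed
  show "f * 1 = f"
  proof (rule ncfps_eqI)
    fix w
    have "nc_nth (f * 1) w = (\<Sum>k\<le>length w. if k = length w then nc_nth f w else 0)"
      unfolding times_ncfps_def one_ncfps_def nc_nth_Abs
      by (rule sum.cong) auto
    then show "nc_nth (f * 1) w = nc_nth f w" by simp
  qed
  show "(f + g) * h = f * h + g * h" "f * (g + h) = f * g + f * h"
    by (simp_all add: times_ncfps_def plus_ncfps_def distrib_left distrib_right sum.distrib)
  show "(0 :: 'a ncfps) \<noteq> 1"
    by (auto simp: zero_ncfps_def one_ncfps_def Abs_ncfps_inject fun_eq_iff)
qed (simp_all add: ncfps_eqI zero_ncfps_def plus_ncfps_def minus_ncfps_def uminus_ncfps_def
      add_ac)

end

lemma nc_nth_0 [simp]: "nc_nth 0 w = 0"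
  and nc_nth_1: "nc_nth 1 w = (if w = [] then 1 else 0)"
  and nc_nth_add [simp]: "nc_nth (f + g) w = nc_nth f w + nc_nth g w"
  and nc_nth_diff [simp]: "nc_nth (f - g) w = nc_nth f w - nc_nth g w"
  and nc_nth_uminus [simp]: "nc_nth (- f) w = - nc_nth f w"
  and nc_nth_mult: "nc_nth (f * g) w = (\<Sum>k\<le>length w. nc_nth f (take k w) * nc_nth g (drop k w))"
  by (simp_all add: zero_ncfps_def one_ncfps_def plus_ncfps_def minus_ncfps_def
      uminus_ncfps_def times_ncfps_def)

lemma nc_nth_mult_Nil [simp]: "nc_nth (f * g) [] = nc_nth f [] * nc_nth g []"
  by (simp add: nc_nth_mult)

definition nc_monom :: "letter list \<Rightarrow> 'a::ring_1 ncfps" where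
  "nc_monom v = Abs_ncfps (\<lambda>w. if w = v then 1 else 0)"

abbreviation ncX :: "'a::ring_1 ncfps" where "ncX \<equiv> nc_monom [LX]"
abbreviation ncY :: "'a::ring_1 ncfps" where "ncY \<equiv> nc_monom [LY]"

lemma nc_monom_append: "nc_monom (u @ v) = (nc_monom u * nc_monom v :: 'a::ring_1 ncfps)"
proof (rule ncfps_eqI)
  fix w
  have "nc_nth (nc_monom u * nc_monom v :: 'a ncfps) w =
      (\<Sum>k\<le>length w. if k = length u \<and> w = u @ v then 1 else 0)"
    unfolding nc_nth_mult
  proof (rule sum.cong)
    fix k assume "k \<in> {..length w}"
    then have "take k w = u \<and> drop k w = v \<longleftrightarrow> k = length u \<and> w = u @ v"
      by (metis append_eq_conv_conj append_take_drop_id atMost_iff length_take min.absorb2)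
    then show "nc_nth (nc_monom u :: 'a ncfps) (take k w) * nc_nth (nc_monom v) (drop k w)
        = (if k = length u \<and> w = u @ v then 1 else 0)"
      by (auto simp: nc_monom_def)
  qed simp
  then show "nc_nth (nc_monom (u @ v) :: 'a ncfps) w = nc_nth (nc_monom u * nc_monom v) w"
    by (auto simp: nc_monom_def)
qed

text \<open>
  Substitution of a series \<open>g\<close> with zero constant term into \<open>F\<close>. Then the \<open>k\<close>-th power of \<open>g\<close>
  has no words shorter than \<open>k\<close> (lemma \<open>nc_nth_power_eq_0\<close>), so truncating the sum at the
  length of \<open>w\<close> loses nothing. The value is meaningless if the constant term of \<open>g\<close> is not zero.
\<close>

definition nc_subst :: "'a::ring_1 fps \<Rightarrow> 'a ncfps \<Rightarrow> 'a ncfps" where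
  "nc_subst F g = Abs_ncfps (\<lambda>w. \<Sum>k\<le>length w. fps_nth F k * nc_nth (g ^ k) w)"

lemma nc_nth_power_eq_0:
  fixes g :: "'a::ring_1 ncfps"
  assumes "nc_nth g [] = 0" "length w < k"
  shows "nc_nth (g ^ k) w = 0"
  using assms(2)
proof (induction k arbitrary: w)
  case (Suc k)
  have "nc_nth g (take i w) * nc_nth (g ^ k) (drop i w) = 0" if "i \<le> length w" for i
  proof (cases "i = 0")
    case True
    then show ?thesis using assms(1) by simp
  next
    case False
    then have "length (drop i w) < k" using Suc.prems that by simp
    then show ?thesis using Suc.IH by simp
  qed
  then show ?case by (simp add: nc_nth_mult)
qed simp

text \<open>
  The inverse of \<open>f = 1 - g\<close>, where \<open>g\<close> has zero constant term, is the geometric series in \<open>g\<close>.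
  It is meaningless if the constant term of \<open>f\<close> is not one.
\<close>

instantiation ncfps :: (ring_1) inverse
begin

definition "inverse f = nc_subst (Abs_fps (\<lambda>k. 1)) (1 - f :: 'a ncfps)"
definition "f div g = f * inverse (g :: 'a ncfps)"

instance ..

end

lemma nc_inverse:
  fixes f :: "'a::ring_1 ncfps"
  assumes "nc_nth f [] = 1"
  shows "f * inverse f = 1" and "inverse f * f = 1"
proof -
  define g where "g = 1 - f"
  have g0: "nc_nth g [] = 0" and f: "f = 1 - g"
    using assms by (simp_all add: g_def nc_nth_1)
  define S where "S = (\<lambda>n. \<Sum>k\<le>n. g ^ k)"
  have nth_sum: "nc_nth (\<Sum>k\<in>A. h k) w = (\<Sum>k\<in>A. nc_nth (h k) w)"
    for A and h :: "nat \<Rightarrow> 'a ncfps" and w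
    by (induction A rule: infinite_finite_induct) simp_all
  have S: "nc_nth (inverse f) w = nc_nth (S n) w" if "length w \<le> n" for w n
  proof -
    have "(\<Sum>k\<le>length w. nc_nth (g ^ k) w) = (\<Sum>k\<le>n. nc_nth (g ^ k) w)"
      using that by (intro sum.mono_neutral_left) (auto simp: nc_nth_power_eq_0[OF g0])
    then show ?thesis
      by (simp add: inverse_ncfps_def nc_subst_def S_def nth_sum g_def)
  qed
  have tele: "(1 - g) * S n = 1 - g ^ Suc n" "S n * (1 - g) = 1 - g ^ Suc n" for n
  proof -
    have S_Suc: "S (Suc n) = S n + g ^ Suc n" for n
      by (simp add: S_def)
    show "(1 - g) * S n = 1 - g ^ Suc n"
    proof (induction n)
      case (Suc n)
      show ?case
        unfolding S_Suc distrib_left Suc.IH by (simp add: left_diff_distrib)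
    qed (simp add: S_def)
    show "S n * (1 - g) = 1 - g ^ Suc n"
    proof (induction n)
      case (Suc n)
      show ?case
        unfolding S_Suc distrib_right Suc.IH
        by (simp add: right_diff_distrib power_commutes mult.assoc)
    qed (simp add: S_def)
  qed
  show "f * inverse f = 1"
  proof (rule ncfps_eqI)
    fix w
    have "nc_nth (f * inverse f) w = nc_nth (f * S (length w)) w"
      unfolding nc_nth_mult by (rule sum.cong) (simp_all add: S[of _ "length w"])
    then show "nc_nth (f * inverse f) w = nc_nth 1 w"
      by (simp only: f tele nc_nth_diff nc_nth_power_eq_0[OF g0 lessI] diff_zero)
  qed
  show "inverse f * f = 1"
  proof (rule ncfps_eqI)
    fix w
    have "nc_nth (inverse f * f) w = nc_nth (S (length w) * f) w"
      unfolding nc_nth_mult by (rule sum.cong) (simp_all add: S[of _ "length w"])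
    then show "nc_nth (inverse f * f) w = nc_nth 1 w"
      by (simp only: f tele nc_nth_diff nc_nth_power_eq_0[OF g0 lessI] diff_zero)
  qed
qed

text \<open>
  The series \<open>\<Sum>j\<ge>1. binom(r+j, j) x^(j-1)\<close>; by lemma \<open>Q_closed_form\<close> this is
  \<open>((1 - x)^(-r-1) - 1) / x\<close>.
\<close>

definition Q :: "nat \<Rightarrow> 'a::comm_ring_1 fps" where
  "Q r = Abs_fps (\<lambda>i. of_nat ((r + Suc i) choose (Suc i)))"

lemma Q_closed_form: "(1 + fps_X * Q r) * (1 - fps_X) ^ (r + 1) = (1 :: 'a::comm_ring_1 fps)"
proof (induction r)
  have nth: "fps_nth (1 + fps_X * Q r :: 'a fps) n = of_nat ((r + n) choose n)" for r n
    by (cases n) (simp_all add: Q_def)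
  have step: "fps_nth ((1 - fps_X) * h) n = fps_nth h n - (if n = 0 then 0 else fps_nth h (n - 1))"
    for h :: "'a fps" and n
    by (simp add: left_diff_distrib)
  {
    case 0
    show ?case
    proof (rule fps_ext)
      fix n
      have "fps_nth ((1 - fps_X) * (1 + fps_X * Q 0) :: 'a fps) n = fps_nth 1 n"
        unfolding step nth by (cases n) simp_all
      then show "fps_nth ((1 + fps_X * Q 0) * (1 - fps_X) ^ (0 + 1) :: 'a fps) n = fps_nth 1 n"
        by (simp only: add_0 power_one_right mult.commute)
    qed
  next
    case (Suc r)
    have "(1 - fps_X) * (1 + fps_X * Q (Suc r)) = (1 + fps_X * Q r :: 'a fps)"
    proof (rule fps_ext)
      fix n
      show "fps_nth ((1 - fps_X) * (1 + fps_X * Q (Suc r))) n = fps_nth (1 + fps_X * Q r :: 'a fps) n"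
        unfolding step nth by (cases n) simp_all
    qed
    moreover have "(1 + fps_X * Q (Suc r)) * (1 - fps_X) ^ (Suc r + 1) =
        ((1 - fps_X) * (1 + fps_X * Q (Suc r))) * (1 - fps_X :: 'a fps) ^ (r + 1)"
      unfolding add_Suc power_Suc mult.assoc by (rule mult.left_commute)
    ultimately show ?case
      using Suc.IH by (simp only:)
  }
qed

text \<open>
  Points of \<open>\<real>\<close>-space of dimension \<open>n = length v + 1\<close> are lists of length \<open>n\<close>. Indices start at 0.
\<close>

definition descent_polytope :: "letter list \<Rightarrow> real list set" where
  "descent_polytope v =
    {p. length p = length v + 1 \<and>
        (\<forall>i < length p. 0 \<le> p ! i \<and> p ! i \<le> 1) \<and>
        (\<forall>i < length v. case v ! i of
            LX \<Rightarrow> p ! i \<le> p ! (i + 1)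
          | LY \<Rightarrow> p ! i \<ge> p ! (i + 1))}"

definition dilate :: "real \<Rightarrow> real list set \<Rightarrow> real list set" where
  "dilate c P = (\<lambda>p. map (\<lambda>t. c * t) p) ` P"

definition ehrhart :: "letter list \<Rightarrow> nat \<Rightarrow> nat" where
  "ehrhart v r = card {p \<in> dilate (real r) (descent_polytope v). set p \<subseteq> \<int>}"

definition ehrhart_gf :: "nat \<Rightarrow> 'a::comm_ring_1 ncfps" where
  "ehrhart_gf r = Abs_ncfps (\<lambda>v. of_nat (ehrhart v r))"

end

theory Submission
  imports Defs
begin

text \<open>
  The proof sorts the lattice points by their first coordinate. Write \<open>T\<^sub>a\<close> for the series that
  counts the points with first coordinate at least \<open>a\<close>, so that \<open>T\<^sub>0\<close> is the generating function
  \<open>I\<close> and \<open>T\<^sub>a = 0\<close> for \<open>a > r\<close>. A point whose first coordinate is exactly \<open>a\<close> is either the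
  single coordinate \<open>a\<close>, or \<open>a\<close> followed by a point that starts at \<open>b \<ge> a\<close> (first letter
  \<open>x\<close>) or at \<open>b \<le> a\<close> (first letter \<open>y\<close>). Hence
  \<open>T\<^sub>a - T\<^bsub>a+1\<^esub> = 1 + x T\<^sub>a + y (I - T\<^bsub>a+1\<^esub>)\<close>, that is,
  \<open>(1 - x) T\<^sub>a = (1 - y) T\<^bsub>a+1\<^esub> + (1 + y I)\<close> (lemma \<open>tail_gf_rec\<close>).

  The substitution \<open>z = (x - y) (1 - y)\<^sup>-\<^sup>1\<close> is the one for which \<open>(1 - z) (1 - y) = 1 - x\<close>. With
  \<open>P\<^sub>a = (1 - y) T\<^sub>a\<close> the recurrence becomes \<open>(1 - z) P\<^sub>a = P\<^bsub>a+1\<^esub> + (1 + y I)\<close>. By Pascal's rule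
  \<open>(1 - z) Q\<^bsub>k+1\<^esub>(z) = Q\<^sub>k(z) + 1\<close> and \<open>(1 - z) Q\<^sub>0(z) = 1\<close>, which is the same recurrence up to the
  right factor \<open>1 + y I\<close>. Since \<open>1 - z\<close> is a unit, descending from \<open>a = r\<close> gives
  \<open>P\<^bsub>r-k\<^esub> = Q\<^sub>k(z) (1 + y I)\<close> (lemma \<open>tail_gf_eq\<close>). For \<open>k = r\<close> this reads \<open>I = G (1 + y I)\<close>
  with \<open>G = (1 - y)\<^sup>-\<^sup>1 Q\<^sub>r(z)\<close>, a linear equation for \<open>I\<close> whose only solution is
  \<open>G (1 - y G)\<^sup>-\<^sup>1\<close>.
\<close>

section \<open>Non-commutative series\<close>

lemma nc_nth_letter_mult:
  "nc_nth (nc_monom [l] * f :: 'a::ring_1 ncfps) w =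
    (case w of [] \<Rightarrow> 0 | m # u \<Rightarrow> if m = l then nc_nth f u else 0)"
proof (cases w)
  case Nil
  then show ?thesis by (simp add: nc_monom_def)
next
  case (Cons m u)
  have "nc_nth (nc_monom [l] * f) w =
      (\<Sum>k\<le>length w. if k = 1 then (if m = l then nc_nth f u else 0) else 0)"
    unfolding nc_nth_mult
  proof (rule sum.cong)
    fix k assume "k \<in> {..length w}"
    have "take k w = [l] \<longleftrightarrow> k = 1 \<and> m = l" if "k \<le> length w"
      using that Cons by (cases k) auto
    with \<open>k \<in> {..length w}\<close> Cons
    show "nc_nth (nc_monom [l]) (take k w) * nc_nth f (drop k w) =
        (if k = 1 then (if m = l then nc_nth f u else 0) else 0)"
      by (auto simp: nc_monom_def)
  qed simp
  then show ?thesis using Cons by (simp add: Suc_le_eq)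
qed

lemma nc_left_cancel:
  fixes f :: "'a::ring_1 ncfps"
  assumes "nc_nth f [] = 1" and "f * g = f * h"
  shows "g = h"
proof -
  have "inverse f * f * g = inverse f * f * h"
    using assms(2) by (simp add: mult.assoc)
  then show ?thesis by (simp add: nc_inverse(2)[OF assms(1)])
qed

text \<open>
  Both sides of the equation \<open>h = g (1 + f h)\<close> are multiplied by \<open>1 - g f\<close>, and
  \<open>(1 - g f) g = g (1 - f g)\<close>.
\<close>

lemma nc_linear_fixpoint:
  fixes f g h :: "'a::ring_1 ncfps"
  assumes "nc_nth f [] = 0" and "h = g * (1 + f * h)"
  shows "h = g * inverse (1 - f * g)"
proof (rule nc_left_cancel)
  show "nc_nth (1 - g * f) [] = 1"
    by (simp add: nc_nth_1 assms(1))
  have "(1 - g * f) * h = g * (1 + f * h) - g * (f * h)"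
    using assms(2) by (simp add: left_diff_distrib mult.assoc)
  also have "\<dots> = g"
    by (simp add: distrib_left)
  also have "\<dots> = g * ((1 - f * g) * inverse (1 - f * g))"
    by (simp add: nc_inverse(1) nc_nth_1 assms(1))
  also have "\<dots> = (1 - g * f) * (g * inverse (1 - f * g))"
    by (simp add: algebra_simps)
  finally show "(1 - g * f) * h = (1 - g * f) * (g * inverse (1 - f * g))" .
qed

section \<open>Substitution into one-variable series\<close>

text \<open>
  The definition of substitution truncates at the length of the word. Letting the bound exceed
  this length makes a single bound serve for all factors of the word.
\<close>

lemma nc_nth_subst:
  assumes "nc_nth g [] = 0" and "length w \<le> n"
  shows "nc_nth (nc_subst F g) w = (\<Sum>k\<le>n. fps_nth F k * nc_nth (g ^ k) w)"
  unfolding nc_subst_def nc_nth_Abs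
  using assms by (intro sum.mono_neutral_left) (auto simp: nc_nth_power_eq_0)

lemma nc_subst_1: "nc_subst 1 g = 1"
proof (rule ncfps_eqI)
  fix w
  have "nc_nth (nc_subst 1 g) w = (\<Sum>k\<le>length w. if k = 0 then nc_nth 1 w else 0)"
    unfolding nc_subst_def nc_nth_Abs by (rule sum.cong) auto
  then show "nc_nth (nc_subst 1 g) w = nc_nth 1 w" by simp
qed

lemma nc_subst_add: "nc_subst (F + H) g = nc_subst F g + nc_subst H g"
  by (rule ncfps_eqI) (simp add: nc_subst_def distrib_right sum.distrib)

lemma nc_subst_diff: "nc_subst (F - H) g = nc_subst F g - nc_subst H g"
  by (rule ncfps_eqI) (simp add: nc_subst_def left_diff_distrib sum_subtractf)

lemma nc_subst_X_mult:
  fixes F :: "'a::comm_ring_1 fps"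
  assumes g: "nc_nth g [] = 0"
  shows "nc_subst (fps_X * F) g = g * nc_subst F g"
proof (rule ncfps_eqI)
  fix w :: "letter list"
  let ?n = "length w"
  have "nc_nth (g * nc_subst F g) w =
      (\<Sum>i\<le>?n. \<Sum>k\<le>?n. nc_nth g (take i w) * (fps_nth F k * nc_nth (g ^ k) (drop i w)))"
    unfolding nc_nth_mult
    by (intro sum.cong) (simp_all add: nc_nth_subst[OF g, of _ ?n] sum_distrib_left)
  also have "\<dots> = (\<Sum>k\<le>?n. fps_nth F k * nc_nth (g ^ Suc k) w)"
    by (subst sum.swap) (simp add: nc_nth_mult sum_distrib_left mult.left_commute)
  also have "\<dots> = (\<Sum>k\<le>Suc ?n. fps_nth (fps_X * F) k * nc_nth (g ^ k) w)"
    unfolding sum.atMost_Suc_shift by simp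
  also have "\<dots> = nc_nth (nc_subst (fps_X * F) g) w"
    by (rule nc_nth_subst[OF g, symmetric]) simp
  finally show "nc_nth (nc_subst (fps_X * F) g) w = nc_nth (g * nc_subst F g) w" ..
qed

lemma nc_subst_one_minus_X_mult:
  fixes F :: "'a::comm_ring_1 fps"
  assumes "nc_nth g [] = 0"
  shows "nc_subst ((1 - fps_X) * F) g = (1 - g) * nc_subst F g"
  by (simp add: left_diff_distrib nc_subst_diff nc_subst_X_mult[OF assms])

lemma Q_0: "(1 - fps_X) * Q 0 = (1 :: 'a::comm_ring_1 fps)"
proof (rule fps_ext)
  fix n
  show "fps_nth ((1 - fps_X) * Q 0 :: 'a fps) n = fps_nth 1 n"
    by (cases n) (simp_all add: Q_def left_diff_distrib)
qed

lemma Q_Suc: "(1 - fps_X) * Q (Suc r) = Q r + (1 :: 'a::comm_ring_1 fps)"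
proof (rule fps_ext)
  fix n
  show "fps_nth ((1 - fps_X) * Q (Suc r) :: 'a fps) n = fps_nth (Q r + 1) n"
    by (cases n) (simp_all add: Q_def left_diff_distrib)
qed

section \<open>Lattice points\<close>

fun letter_rel :: "letter \<Rightarrow> 'a::linorder \<Rightarrow> 'a \<Rightarrow> bool" where
  "letter_rel LX s t \<longleftrightarrow> s \<le> t"
| "letter_rel LY s t \<longleftrightarrow> t \<le> s"

definition lattice_points :: "nat \<Rightarrow> letter list \<Rightarrow> nat list set" where
  "lattice_points r v =
    {p. length p = length v + 1 \<and> (\<forall>i < length p. p ! i \<le> r) \<and>
        (\<forall>i < length v. letter_rel (v ! i) (p ! i) (p ! (i + 1)))}"

lemma finite_lattice_points: "finite (lattice_points r v)"
proof (rule finite_subset)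
  show "lattice_points r v \<subseteq> {p. set p \<subseteq> {..r} \<and> length p = length v + 1}"
    by (auto simp: lattice_points_def in_set_conv_nth)
qed (rule finite_lists_length_eq, simp)

lemma lattice_points_Nil: "lattice_points r [] = (\<lambda>a. [a]) ` {..r}"
  by (auto simp: lattice_points_def length_Suc_conv)

lemma Cons_in_lattice_points:
  "a # q \<in> lattice_points r (l # v) \<longleftrightarrow>
    a \<le> r \<and> q \<in> lattice_points r v \<and> letter_rel l a (hd q)"
  by (cases q) (auto simp: lattice_points_def All_less_Suc2)

lemma hd_lattice_point_le: "p \<in> lattice_points r v \<Longrightarrow> hd p \<le> r"
  by (cases p) (auto simp: lattice_points_def)

lemma lattice_points_hd_eq:
  assumes "a \<le> r"
  shows "{p \<in> lattice_points r (l # v). hd p = a} =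
    (#) a ` {q \<in> lattice_points r v. letter_rel l a (hd q)}" (is "?L = ?R")
proof
  show "?L \<subseteq> ?R"
  proof
    fix p assume p: "p \<in> ?L"
    then obtain q where "p = a # q"
      by (cases p) (auto simp: lattice_points_def)
    with p show "p \<in> ?R" by (auto simp: Cons_in_lattice_points)
  qed
  show "?R \<subseteq> ?L" using assms by (auto simp: Cons_in_lattice_points)
qed

text \<open>
  The uniform rescaling by \<open>1 / r\<close> also covers \<open>r = 0\<close>: all coordinates of a point of the dilation
  are then 0, and division by 0 sends them to the origin, which lies in the polytope.
\<close>

lemma dilate_descent_polytope:
  "dilate (real r) (descent_polytope v) =
    {p. length p = length v + 1 \<and> (\<forall>i < length p. 0 \<le> p ! i \<and> p ! i \<le> real r) \<and>
        (\<forall>i < length v. letter_rel (v ! i) (p ! i) (p ! (i + 1)))}" (is "_ = ?R")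
proof
  show "dilate (real r) (descent_polytope v) \<subseteq> ?R"
  proof
    fix p assume "p \<in> dilate (real r) (descent_polytope v)"
    then obtain q where q: "q \<in> descent_polytope v" "p = map (\<lambda>t. real r * t) q"
      by (auto simp: dilate_def)
    have "letter_rel (v ! i) (p ! i) (p ! (i + 1))" if "i < length v" for i
      using q that by (cases "v ! i") (auto simp: descent_polytope_def mult_left_mono)
    moreover have "0 \<le> p ! i \<and> p ! i \<le> real r" if "i < length p" for i
      using q that by (auto simp: descent_polytope_def mult_left_le)
    ultimately show "p \<in> ?R" using q by (simp add: descent_polytope_def)
  qed
  show "?R \<subseteq> dilate (real r) (descent_polytope v)"
  proof
    fix p assume p: "p \<in> ?R"
    let ?q = "map (\<lambda>t. t / real r) p"
    have "real r * (p ! i / real r) = p ! i" if "i < length p" for i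
      using p that by (cases "r = 0") force+
    then have "p = map (\<lambda>t. real r * t) ?q"
      by (intro nth_equalityI) auto
    moreover have "?q \<in> descent_polytope v"
    proof -
      have "case v ! i of LX \<Rightarrow> ?q ! i \<le> ?q ! (i + 1) | LY \<Rightarrow> ?q ! i \<ge> ?q ! (i + 1)"
        if "i < length v" for i
      proof -
        have "letter_rel (v ! i) (p ! i) (p ! (i + 1))" "length p = length v + 1"
          using p that by auto
        with that show ?thesis by (cases "v ! i") (auto simp: divide_right_mono)
      qed
      moreover have "0 \<le> ?q ! i \<and> ?q ! i \<le> 1" if "i < length ?q" for i
        using p that by (auto simp: divide_le_eq_1)
      ultimately show ?thesis using p by (simp add: descent_polytope_def)
    qed
    ultimately show "p \<in> dilate (real r) (descent_polytope v)"
      unfolding dilate_def by blast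
  qed
qed

lemma letter_rel_of_nat: "letter_rel l (real s) (real t) \<longleftrightarrow> letter_rel l s t"
  by (cases l) simp_all

lemma ehrhart_eq_card_lattice_points: "ehrhart v r = card (lattice_points r v)"
proof -
  have "{p \<in> dilate (real r) (descent_polytope v). set p \<subseteq> \<int>} =
      map real ` lattice_points r v" (is "?L = ?R")
  proof
    show "?L \<subseteq> ?R"
    proof
      fix p assume p: "p \<in> ?L"
      define q where "q = map (\<lambda>t. nat \<lfloor>t\<rfloor>) p"
      have "real (nat \<lfloor>t\<rfloor>) = t" if "t \<in> set p" for t
      proof -
        have "t \<in> \<int>" using p that by blast
        moreover have "0 \<le> t"
          using p that by (auto simp: dilate_descent_polytope in_set_conv_nth)
        ultimately show ?thesis by (auto elim!: Ints_cases)
      qed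
      then have pq: "p = map real q" by (simp add: q_def map_idI)
      with p have "q \<in> lattice_points r v"
        by (auto simp: dilate_descent_polytope lattice_points_def letter_rel_of_nat)
      with pq show "p \<in> ?R" by blast
    qed
    show "?R \<subseteq> ?L"
      by (auto simp: dilate_descent_polytope lattice_points_def letter_rel_of_nat)
  qed
  then show ?thesis
    by (simp add: ehrhart_def card_image inj_on_subset[OF inj_mapI] inj_on_def)
qed

section \<open>Sorting by the first coordinate\<close>

definition tail_points :: "nat \<Rightarrow> nat \<Rightarrow> letter list \<Rightarrow> nat list set" where
  "tail_points r a v = {p \<in> lattice_points r v. a \<le> hd p}"

definition tail_gf :: "nat \<Rightarrow> nat \<Rightarrow> 'a::comm_ring_1 ncfps" where
  "tail_gf r a = Abs_ncfps (\<lambda>v. of_nat (card (tail_points r a v)))"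

lemma nc_nth_tail_gf: "nc_nth (tail_gf r a) v = of_nat (card (tail_points r a v))"
  by (simp add: tail_gf_def)

lemma tail_gf_0: "tail_gf r 0 = ehrhart_gf r"
  by (simp add: tail_gf_def ehrhart_gf_def tail_points_def ehrhart_eq_card_lattice_points)

lemma tail_gf_beyond: "tail_gf r (Suc r) = 0"
proof -
  have "tail_points r (Suc r) v = {}" for v
    using hd_lattice_point_le by (fastforce simp: tail_points_def)
  then show ?thesis by (intro ncfps_eqI) (simp add: nc_nth_tail_gf)
qed

lemma card_tail_points_step:
  "card (tail_points r a v) =
    card {p \<in> lattice_points r v. hd p = a} + card (tail_points r (Suc a) v)"
proof -
  have "tail_points r a v = {p \<in> lattice_points r v. hd p = a} \<union> tail_points r (Suc a) v"
    by (auto simp: tail_points_def)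
  then show ?thesis
    by (simp add: card_Un_disjoint disjoint_iff tail_points_def finite_lattice_points)
qed

lemma card_lattice_points_hd_eq:
  assumes "a \<le> r"
  shows "card {p \<in> lattice_points r (l # v). hd p = a} =
    card {q \<in> lattice_points r v. letter_rel l a (hd q)}"
  by (simp add: lattice_points_hd_eq[OF assms] card_image)

text \<open>
  After a first letter \<open>y\<close> the point goes on with a coordinate at most \<open>a\<close>. Counting these by
  complement keeps the recurrence in terms of tails only, at the price of the unknown \<open>T\<^sub>0 = I\<close>.
\<close>

lemma card_tail_points_0:
  "card (tail_points r 0 v) =
    card {q \<in> lattice_points r v. hd q \<le> a} + card (tail_points r (Suc a) v)"
proof -
  have "tail_points r 0 v = {q \<in> lattice_points r v. hd q \<le> a} \<union> tail_points r (Suc a) v"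
    by (auto simp: tail_points_def)
  moreover have "{q \<in> lattice_points r v. hd q \<le> a} \<inter> tail_points r (Suc a) v = {}"
    by (auto simp: tail_points_def)
  ultimately show ?thesis
    by (simp only:) (rule card_Un_disjoint, simp_all add: finite_lattice_points tail_points_def)
qed

text \<open>
  The coefficients at the empty word, at words starting with \<open>x\<close> and at words starting with \<open>y\<close>
  are the three ways in which a point with first coordinate exactly \<open>a\<close> can continue.
\<close>

lemma tail_gf_rec:
  assumes "a \<le> r"
  shows "(1 - ncX) * tail_gf r a =
    (1 - ncY) * tail_gf r (Suc a) + (1 + ncY * tail_gf r 0 :: 'a::comm_ring_1 ncfps)"
proof (rule ncfps_eqI)
  fix w
  have step: "(of_nat (card (tail_points r a w)) :: 'a) =
      of_nat (card {p \<in> lattice_points r w. hd p = a}) + of_nat (card (tail_points r (Suc a) w))"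
    by (simp add: card_tail_points_step[of r a])
  show "nc_nth ((1 - ncX) * tail_gf r a) w =
      nc_nth ((1 - ncY) * tail_gf r (Suc a) + (1 + ncY * tail_gf r 0 :: 'a ncfps)) w"
  proof (cases w)
    case Nil
    have "{p \<in> lattice_points r []. hd p = a} = {[a]}"
      using assms by (auto simp: lattice_points_Nil)
    with Nil step show ?thesis
      by (simp add: left_diff_distrib nc_nth_letter_mult nc_nth_1 nc_nth_tail_gf
          del: nc_nth_mult_Nil)
  next
    case (Cons l v)
    show ?thesis
    proof (cases l)
      case LX
      with Cons step show ?thesis
        by (simp add: left_diff_distrib nc_nth_letter_mult nc_nth_1 nc_nth_tail_gf
            card_lattice_points_hd_eq[OF assms] flip: tail_points_def)
    next
      case LY
      with Cons step show ?thesis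
        by (simp add: left_diff_distrib nc_nth_letter_mult nc_nth_1 nc_nth_tail_gf
            card_lattice_points_hd_eq[OF assms] card_tail_points_0[of r v a])
    qed
  qed
qed

section \<open>Solving the recurrence\<close>

text \<open>
  The induction runs downwards in the first coordinate \<open>r - k\<close>, starting from the vanishing tail
  at \<open>r + 1\<close>. The factor \<open>1 + y I\<close> does not depend on the coordinate and stays on the right, so
  non-commutativity does no harm.
\<close>

lemma tail_gf_eq:
  fixes r :: nat
  defines "z \<equiv> (ncX - ncY) * inverse (1 - ncY) :: 'a::comm_ring_1 ncfps"
  assumes "k \<le> r"
  shows "(1 - ncY) * tail_gf r (r - k) = nc_subst (Q k) z * (1 + ncY * tail_gf r 0)"
proof -
  have Y: "nc_nth (1 - ncY :: 'a ncfps) [] = 1"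
    by (simp add: nc_nth_1 nc_monom_def)
  have z0: "nc_nth z [] = 0"
    by (simp add: z_def nc_monom_def)
  have unit: "nc_nth (1 - z) [] = 1"
    by (simp add: nc_nth_1 z0)
  have "(1 - z) * (1 - ncY) = 1 - ncX"
    by (simp add: z_def left_diff_distrib mult.assoc nc_inverse(2)[OF Y])
  then have rec: "(1 - z) * ((1 - ncY) * tail_gf r a) =
      (1 - ncY) * tail_gf r (Suc a) + (1 + ncY * tail_gf r 0)" if "a \<le> r" for a
    using tail_gf_rec[OF that, where ?'a = 'a] by (simp flip: mult.assoc)
  show ?thesis
    using assms(2)
  proof (induction k)
    case 0
    have "(1 - z) * nc_subst (Q 0) z = 1"
      by (simp add: nc_subst_1 Q_0 flip: nc_subst_one_minus_X_mult[OF z0])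
    then have "(1 - z) * (nc_subst (Q 0) z * (1 + ncY * tail_gf r 0)) = 1 + ncY * tail_gf r 0"
      by (simp flip: mult.assoc)
    also have "\<dots> = (1 - z) * ((1 - ncY) * tail_gf r r)"
      by (simp add: rec tail_gf_beyond)
    finally show ?case using nc_left_cancel[OF unit] by (metis diff_zero)
  next
    case (Suc k)
    have "(1 - z) * nc_subst (Q (Suc k)) z = nc_subst (Q k) z + 1"
      by (simp add: nc_subst_1 nc_subst_add Q_Suc flip: nc_subst_one_minus_X_mult[OF z0])
    then have "(1 - z) * (nc_subst (Q (Suc k)) z * (1 + ncY * tail_gf r 0)) =
        nc_subst (Q k) z * (1 + ncY * tail_gf r 0) + (1 + ncY * tail_gf r 0)"
      by (simp add: distrib_right flip: mult.assoc)
    also have "\<dots> = (1 - ncY) * tail_gf r (Suc (r - Suc k)) + (1 + ncY * tail_gf r 0)"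
      using Suc by (simp add: Suc_diff_Suc)
    also have "\<dots> = (1 - z) * ((1 - ncY) * tail_gf r (r - Suc k))"
      by (simp add: rec)
    finally show ?case using nc_left_cancel[OF unit] by metis
  qed
qed

theorem theorem4p2:
  fixes r :: nat
  shows "(ehrhart_gf r :: 'a::comm_ring_1 ncfps) =
    inverse (1 - ncY) * nc_subst (Q r) ((ncX - ncY) * inverse (1 - ncY)) *
    inverse (1 - ncY * inverse (1 - ncY) * nc_subst (Q r) ((ncX - ncY) * inverse (1 - ncY)))"
proof -
  define G :: "'a ncfps" where
    "G = inverse (1 - ncY) * nc_subst (Q r) ((ncX - ncY) * inverse (1 - ncY))"
  let ?I = "ehrhart_gf r :: 'a ncfps"
  have Y: "nc_nth ncY [] = (0 :: 'a)"
    by (simp add: nc_monom_def)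
  have unit: "nc_nth (1 - ncY) [] = (1 :: 'a)"
    by (simp add: nc_nth_1 Y)
  have "(1 - ncY) * ?I = (1 - ncY) * (G * (1 + ncY * ?I))"
    using tail_gf_eq[of r r, where ?'a = 'a]
    by (simp add: tail_gf_0 G_def nc_inverse(1)[OF unit] flip: mult.assoc)
  then have "?I = G * (1 + ncY * ?I)"
    by (rule nc_left_cancel[OF unit])
  then have "?I = G * inverse (1 - ncY * G)"
    by (rule nc_linear_fixpoint[OF Y])
  then show ?thesis by (simp add: G_def mult.assoc)
qed

end
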